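(* $gr^3_2(B_8)=13$.
   Context: $K_n$ is the complete graph of order $n$. The book $B_n:=K_2+nK_1$ (graph join) is the graph on $n+2$ vertices consisting of an edge $xy$ (the spine) together with $n$ further, pairwise non-adjacent vertices (the pages), each adjacent to both $x$ and $y$. A $t$-coloring of $K_p$ is a map $f:E(K_p)\to\{1,\dots,t\}$, not assumed surjective. A Gallai $t$-coloring is a $t$-coloring with no rainbow triangle, i.e. there are no three vertices $x,y,z$ such that $f(xy),f(xz),f(yz)$ are pairwise distinct. For $1\le s<t$ and a graph $G$, the weakened Gallai-Ramsey number $gr^t_s(G)$ is the least $p\in\mathbb{N}$ such that every Gallai $t$-coloring of $K_p$ contains a (not necessarily induced) subgraph isomorphic to $G$ whose edges use at most $s$ colors. *)

theory Defs
  imports "HOL-Library.Ramsey" "HOL-Library.FuncSet"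
begin

text \<open>
  A graph is a pair of a vertex set and an edge set; it is a finite simple graph when the edges
  are two-element subsets of a finite vertex set.
\<close>

type_synonym 'a graph = "'a set \<times> 'a set set"

abbreviation verts :: "'a graph \<Rightarrow> 'a set" where
  "verts G \<equiv> fst G"

abbreviation edges :: "'a graph \<Rightarrow> 'a set set" where
  "edges G \<equiv> snd G"

definition simple_graph :: "'a graph \<Rightarrow> bool" where
  "simple_graph G \<longleftrightarrow> finite (verts G) \<and> edges G \<subseteq> [verts G]\<^bsup>2\<^esup>"

definition subgraph :: "'a graph \<Rightarrow> 'a graph \<Rightarrow> bool" where
  "subgraph H G \<longleftrightarrow> simple_graph H \<and> verts H \<subseteq> verts G \<and> edges H \<subseteq> edges G"

definition graph_iso :: "'a graph \<Rightarrow> 'b graph \<Rightarrow> bool" where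
  "graph_iso G H \<longleftrightarrow>
     (\<exists>\<phi>. bij_betw \<phi> (verts G) (verts H) \<and>
          (\<forall>u \<in> verts G. \<forall>v \<in> verts G. {u, v} \<in> edges G \<longleftrightarrow> {\<phi> u, \<phi> v} \<in> edges H))"

definition complete_graph :: "nat \<Rightarrow> nat graph" where
  "complete_graph n = ({..<n}, [{..<n}]\<^bsup>2\<^esup>)"

text \<open>The graph \<open>n K\<^sub>1\<close>.\<close>

definition empty_graph :: "nat \<Rightarrow> nat graph" where
  "empty_graph n = ({..<n}, {})"

definition graph_join :: "'a graph \<Rightarrow> 'b graph \<Rightarrow> ('a + 'b) graph" where
  "graph_join G H =
     (verts G <+> verts H,
      (`) Inl ` edges G \<union> (`) Inr ` edges H \<union> {{Inl u, Inr v} | u v. u \<in> verts G \<and> v \<in> verts H})"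

definition book :: "nat \<Rightarrow> (nat + nat) graph" where
  "book n = graph_join (complete_graph 2) (empty_graph n)"

definition coloring :: "nat \<Rightarrow> nat \<Rightarrow> (nat set \<Rightarrow> nat) \<Rightarrow> bool" where
  "coloring t p f \<longleftrightarrow> f \<in> edges (complete_graph p) \<rightarrow> {1..t}"

definition rainbow_triangle :: "nat \<Rightarrow> (nat set \<Rightarrow> nat) \<Rightarrow> bool" where
  "rainbow_triangle p f \<longleftrightarrow>
     (\<exists>x \<in> verts (complete_graph p). \<exists>y \<in> verts (complete_graph p). \<exists>z \<in> verts (complete_graph p).
        distinct [x, y, z] \<and> distinct [f {x, y}, f {x, z}, f {y, z}])"

definition gallai_coloring :: "nat \<Rightarrow> nat \<Rightarrow> (nat set \<Rightarrow> nat) \<Rightarrow> bool" where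
  "gallai_coloring t p f \<longleftrightarrow> coloring t p f \<and> \<not> rainbow_triangle p f"

text \<open>
  The infimum in \<^typ>\<open>nat\<close> is the least element of a nonempty set. Its value on the empty set is
  \<open>0\<close>, which is never the correct value for a graph with at least one vertex, so an equation
  \<open>weakened_gallai_ramsey t s G = p\<close> with \<open>p > 0\<close> includes the claim that such an order exists.
\<close>

definition weakened_gallai_ramsey :: "nat \<Rightarrow> nat \<Rightarrow> 'a graph \<Rightarrow> nat" where
  "weakened_gallai_ramsey t s G =
     Inf {p. \<forall>f. gallai_coloring t p f \<longrightarrow>
               (\<exists>H. subgraph H (complete_graph p) \<and> graph_iso G H \<and> card (f ` edges H) \<le> s)}"

end

theory Submission
  imports Defs "HOL-Library.Disjoint_Sets"
begin

text \<open>
  If a Gallai 3-coloring of \<open>K\<^sub>1\<^sub>3\<close> has no book \<open>B\<^sub>8\<close> with at most two colors, then for each edge \<open>xy\<close>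
  and each color \<open>b\<close> other than its own there are at least four vertices joined to \<open>x\<close> or \<open>y\<close> in
  color \<open>b\<close>. By Gallai's lemma some color \<open>c\<close> is disconnected, and its components are joined
  pairwise in a single color. The condition on the edges between components bounds the component
  sizes from below. If no two-block partition has all its cross edges in one color, this forces
  exactly four components, whose quotient consists of two complementary paths; an end of such a
  path has too few neighbors in one color. Otherwise the smaller block is a single vertex because
  \<open>R(3,3) = 6\<close>, and the same analysis applies to the remaining twelve vertices. Four blocks of size
  three on such a pair of paths give a coloring of \<open>K\<^sub>1\<^sub>2\<close> without such a book.
\<close>

section \<open>Gallai 3-colorings of a finite vertex set\<close>

text \<open>The vertex set is arbitrary so that the notion passes to subsets; the induction for
  Gallai's lemma and the removal of one vertex from thirteen rely on this.\<close>

definition gallai_on :: "'a set \<Rightarrow> ('a set \<Rightarrow> nat) \<Rightarrow> bool" where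
  "gallai_on V f \<longleftrightarrow> finite V \<and>
     (\<forall>x\<in>V. \<forall>y\<in>V. x \<noteq> y \<longrightarrow> f {x, y} \<in> {1, 2, 3}) \<and>
     (\<forall>x\<in>V. \<forall>y\<in>V. \<forall>z\<in>V. distinct [x, y, z] \<longrightarrow> \<not> distinct [f {x, y}, f {x, z}, f {y, z}])"

definition nbr :: "'a set \<Rightarrow> ('a set \<Rightarrow> nat) \<Rightarrow> nat \<Rightarrow> 'a \<Rightarrow> 'a set" where
  "nbr V f c x = {z \<in> V. z \<noteq> x \<and> f {x, z} = c}"

definition color_rel :: "'a set \<Rightarrow> ('a set \<Rightarrow> nat) \<Rightarrow> nat \<Rightarrow> 'a rel" where
  "color_rel V f c = {(x, y). x \<in> V \<and> y \<in> V \<and> x \<noteq> y \<and> f {x, y} = c}"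

definition mono_cut :: "'a set \<Rightarrow> ('a set \<Rightarrow> nat) \<Rightarrow> bool" where
  "mono_cut V f \<longleftrightarrow> (\<exists>A B d. A \<union> B = V \<and> A \<inter> B = {} \<and> A \<noteq> {} \<and> B \<noteq> {} \<and>
     (\<forall>x\<in>A. \<forall>y\<in>B. f {x, y} = d))"

text \<open>The color \<open>c\<close> is absent between parts, so the quotient is a complete graph
  in at most two colors. The parts will be the components of \<open>c\<close>.\<close>

definition mono_partition :: "'a set \<Rightarrow> ('a set \<Rightarrow> nat) \<Rightarrow> nat \<Rightarrow> 'a set set \<Rightarrow> bool" where
  "mono_partition V f c \<P> \<longleftrightarrow> partition_on V \<P> \<and>
     (\<forall>P\<in>\<P>. \<forall>Q\<in>\<P>. P \<noteq> Q \<longrightarrow> (\<exists>d\<in>{1, 2, 3} - {c}. \<forall>x\<in>P. \<forall>y\<in>Q. f {x, y} = d))"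

lemma gallai_on_finite: "gallai_on V f \<Longrightarrow> finite V"
  by (simp add: gallai_on_def)

lemma gallai_on_color: "gallai_on V f \<Longrightarrow> x \<in> V \<Longrightarrow> y \<in> V \<Longrightarrow> x \<noteq> y \<Longrightarrow> f {x, y} \<in> {1, 2, 3}"
  by (simp add: gallai_on_def)

lemma gallai_on_triangle:
  assumes "gallai_on V f" "x \<in> V" "y \<in> V" "z \<in> V" "x \<noteq> y" "x \<noteq> z" "y \<noteq> z"
  shows "f {x, y} = f {x, z} \<or> f {x, y} = f {y, z} \<or> f {x, z} = f {y, z}"
  using assms unfolding gallai_on_def by auto

lemma gallai_on_subset: "gallai_on V f \<Longrightarrow> W \<subseteq> V \<Longrightarrow> gallai_on W f"
  unfolding gallai_on_def by (meson finite_subset subsetD)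

lemma third_color:
  fixes c d :: nat
  assumes "c \<in> {1, 2, 3}" "d \<in> {1, 2, 3}" "c \<noteq> d"
  obtains e where "e \<in> {1, 2, 3}" "e \<noteq> c" "e \<noteq> d" "{1, 2, 3} = {c, d, e}"
proof -
  \<comment> \<open>The three colors sum to 6.\<close>
  have "6 - c - d \<in> {1, 2, 3} \<and> 6 - c - d \<noteq> c \<and> 6 - c - d \<noteq> d \<and> {1, 2, 3} = {c, d, 6 - c - d}"
    using assms by auto
  then show ?thesis using that by blast
qed

lemma other_colors:
  fixes c :: nat
  assumes "c \<in> {1, 2, 3}"
  obtains a b where "a \<noteq> b" "a \<noteq> c" "b \<noteq> c" "{1, 2, 3} = {a, b, c}"
proof -
  obtain d where d: "d \<in> {1, 2, 3::nat}" "c \<noteq> d"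
    using assms by (metis insertCI n_not_Suc_n numeral_2_eq_2 One_nat_def)
  from third_color[OF assms d] obtain e where "e \<noteq> c" "e \<noteq> d" "{1, 2, 3} = {c, d, e}"
    by metis
  then show ?thesis using that[of d e] d by blast
qed

lemma nbr_iff: "z \<in> nbr V f c x \<longleftrightarrow> z \<in> V \<and> z \<noteq> x \<and> f {x, z} = c"
  by (simp add: nbr_def)

lemma finite_nbr [simp]: "finite V \<Longrightarrow> finite (nbr V f c x)"
  by (simp add: nbr_def)

section \<open>Components of a color and Gallai's lemma\<close>

lemma sym_color_rel: "sym ((color_rel V f c)\<^sup>*)"
  by (rule sym_rtrancl) (auto simp: sym_def color_rel_def insert_commute)

lemma color_rel_closed: "(x, y) \<in> (color_rel V f c)\<^sup>* \<Longrightarrow> x \<in> V \<Longrightarrow> y \<in> V"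
  by (induction rule: rtrancl_induct) (auto simp: color_rel_def)

text \<open>For a \<open>c\<close>-edge \<open>u w\<close> in the component of \<open>x\<close>, the
  triangle \<open>u w y\<close> has neither of its edges at \<open>y\<close> in color
  \<open>c\<close>, so these two agree. The color seen from \<open>y\<close> is therefore constant
  on the component.\<close>

lemma component_mono:
  assumes g: "gallai_on V f" and "(x, x') \<in> (color_rel V f c)\<^sup>*"
    and x: "x \<in> V" and y: "y \<in> V" and n: "(x, y) \<notin> (color_rel V f c)\<^sup>*"
  shows "f {x', y} = f {x, y} \<and> f {x', y} \<noteq> c \<and> x' \<noteq> y"
  using assms(2)
proof (induction rule: rtrancl_induct)
  case base
  have "x \<noteq> y" using n by auto
  moreover have "f {x, y} \<noteq> c"
    using n x y \<open>x \<noteq> y\<close> by (auto simp: color_rel_def)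
  ultimately show ?case by simp
next
  case (step u w)
  have w: "(x, w) \<in> (color_rel V f c)\<^sup>*" using step by (meson rtrancl_into_rtrancl)
  have e: "u \<in> V" "w \<in> V" "u \<noteq> w" "f {u, w} = c"
    using step by (auto simp: color_rel_def)
  have "w \<noteq> y" using w n by auto
  moreover have "f {w, y} \<noteq> c"
  proof
    assume "f {w, y} = c"
    then have "(w, y) \<in> color_rel V f c" using e y \<open>w \<noteq> y\<close> by (simp add: color_rel_def)
    then show False using w n by (meson rtrancl_into_rtrancl)
  qed
  moreover have "f {w, y} = f {u, y}"
    using gallai_on_triangle[OF g, of u w y] e y step.IH \<open>w \<noteq> y\<close> \<open>f {w, y} \<noteq> c\<close> by auto
  ultimately show ?case using step.IH by simp
qed

lemma component_mono2:
  assumes g: "gallai_on V f"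
    and "(x, x') \<in> (color_rel V f c)\<^sup>*" "(y, y') \<in> (color_rel V f c)\<^sup>*"
    and x: "x \<in> V" and y: "y \<in> V" and n: "(x, y) \<notin> (color_rel V f c)\<^sup>*"
  shows "f {x', y'} = f {x, y}" "f {x', y'} \<noteq> c" "x' \<noteq> y'"
proof -
  let ?R = "(color_rel V f c)\<^sup>*"
  have 1: "f {x', y} = f {x, y}" using component_mono[OF g assms(2) x y n] by simp
  have x': "x' \<in> V" using color_rel_closed assms(2) x by metis
  have "(x', y) \<notin> ?R" using n assms(2) by (meson rtrancl_trans)
  then have "(y, x') \<notin> ?R" using sym_color_rel by (meson symD)
  from component_mono[OF g assms(3) y x' this]
  show "f {x', y'} = f {x, y}" "f {x', y'} \<noteq> c" "x' \<noteq> y'" using 1 by (auto simp: insert_commute)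
qed

text \<open>A \<open>c\<close>-path from \<open>u\<close> in the enlarged set either stays in
  \<open>W\<close> or first arrives at \<open>v\<close> from a vertex that was reached inside
  \<open>W\<close>.\<close>

lemma reach_through_new_vertex:
  assumes "(u, z) \<in> (color_rel (insert v W) f c)\<^sup>*" "u \<in> W"
  shows "(\<exists>w\<in>W. (u, w) \<in> (color_rel W f c)\<^sup>* \<and> f {v, w} = c) \<or> (z \<in> W \<and> (u, z) \<in> (color_rel W f c)\<^sup>*)"
  using assms(1)
proof (induction rule: rtrancl_induct)
  case base
  then show ?case using assms(2) by simp
next
  case (step s t)
  show ?case
  proof (cases "\<exists>w\<in>W. (u, w) \<in> (color_rel W f c)\<^sup>* \<and> f {v, w} = c")
    case False
    then have s: "s \<in> W" "(u, s) \<in> (color_rel W f c)\<^sup>*" using step.IH by auto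
    have "t \<in> W"
    proof (rule ccontr)
      assume "t \<notin> W"
      then have "t = v" "f {v, s} = c" using step by (auto simp: color_rel_def insert_commute)
      then show False using False s by auto
    qed
    then have "(s, t) \<in> color_rel W f c" using step s by (auto simp: color_rel_def)
    then show ?thesis using s \<open>t \<in> W\<close> by (meson rtrancl_into_rtrancl)
  qed simp
qed

text \<open>
  Gallai's lemma. When a vertex \<open>v\<close> is added to \<open>W\<close>, whose color \<open>c\<close> is disconnected, and \<open>c\<close> becomes
  connected, then \<open>v\<close> has a \<open>c\<close>-edge to each \<open>c\<close>-component of \<open>W\<close>. An \<open>a\<close>-edge from \<open>v\<close> to a
  component therefore forces color \<open>a\<close> between this component and all others, and these
  demands collide for the two colors different from \<open>c\<close>.
\<close>

lemma gallai_disconnected_color: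
  assumes "gallai_on V f" "card V \<ge> 2"
  shows "\<exists>c\<in>{1, 2, 3}. \<exists>x\<in>V. \<exists>y\<in>V. (x, y) \<notin> (color_rel V f c)\<^sup>*"
proof -
  have "finite V" using assms(1) by (rule gallai_on_finite)
  then show ?thesis using assms
  proof (induction V rule: finite_induct)
    case empty
    then show ?case by simp
  next
    case (insert v W)
    have gV: "gallai_on (insert v W) f" by fact
    have gW: "gallai_on W f" using gV gallai_on_subset by blast
    show ?case
    proof (cases "card W \<ge> 2")
      case False
      then have "card W = 1" using insert by simp
      then obtain w where W: "W = {w}" by (rule card_1_singletonE)
      then have vw: "v \<noteq> w" using insert by auto
      obtain c :: nat where c: "c \<in> {1, 2, 3}" "c \<noteq> f {v, w}"
        by (metis insertCI n_not_Suc_n numeral_2_eq_2 One_nat_def)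
      have "color_rel (insert v W) f c = {}"
        using c W by (auto simp: color_rel_def insert_commute)
      then show ?thesis using c W vw by auto
    next
      case True
      from insert.IH[OF gW True] obtain c x y where
        c: "c \<in> {1, 2, 3}" and x: "x \<in> W" and y: "y \<in> W"
        and nxy: "(x, y) \<notin> (color_rel W f c)\<^sup>*" by blast
      show ?thesis
      proof (rule ccontr)
        assume "\<not> ?thesis"
        then have conn: "(s, t) \<in> (color_rel (insert v W) f d)\<^sup>*"
          if "d \<in> {1, 2, 3}" "s \<in> insert v W" "t \<in> insert v W" for d s t
          using that by blast
        have rep: "\<exists>w\<in>W. (u, w) \<in> (color_rel W f c)\<^sup>* \<and> f {v, w} = c" if "u \<in> W" for u
          using reach_through_new_vertex[OF conn[OF c, of u v] that] that insert.hyps by auto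
        have edge: "\<exists>u\<in>W. f {v, u} = a" if "a \<in> {1, 2, 3}" for a
        proof -
          have "v \<noteq> x" using x insert.hyps by auto
          have "(v, x) \<in> (color_rel (insert v W) f a)\<^sup>*" using conn[OF that] x by simp
          then obtain u where "(v, u) \<in> color_rel (insert v W) f a"
            using \<open>v \<noteq> x\<close> by (meson converse_rtranclE)
          then show ?thesis by (auto simp: color_rel_def)
        qed
        have forced: "f {u, w} = a"
          if a: "a \<noteq> c" "u \<in> W" "f {v, u} = a" and w: "w \<in> W" "(u, w) \<notin> (color_rel W f c)\<^sup>*"
          for a u w
        proof -
          obtain w' where w': "w' \<in> W" "(w, w') \<in> (color_rel W f c)\<^sup>*" "f {v, w'} = c"
            using rep[OF w(1)] by blast
          note m = component_mono2[OF gW rtrancl_refl w'(2) a(2) w]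
          \<comment> \<open>In the triangle \<open>v u w'\<close> the edge \<open>v u\<close> has
            color \<open>a\<close>, \<open>v w'\<close> has color \<open>c\<close>, and
            \<open>u w'\<close> is not \<open>c\<close>; hence it is \<open>a\<close>.\<close>
          have "v \<noteq> u" "v \<noteq> w'" using insert.hyps a w' by auto
          then have "f {u, w'} = a"
            using gallai_on_triangle[OF gV, of v u w'] a w' m by auto
          then show ?thesis using m by simp
        qed
        obtain a b where ab: "a \<noteq> b" "a \<noteq> c" "b \<noteq> c" "{1, 2, 3} = {a, b, c}"
          using other_colors[OF c] .
        obtain u where u: "u \<in> W" "f {v, u} = a" using edge[of a] ab by auto
        obtain u' where u': "u' \<in> W" "f {v, u'} = b" using edge[of b] ab by auto
        show False
        \<comment> \<open>In different components, the edge \<open>u u'\<close> itself would carry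
          both colors. In a common component, \<open>u\<close> and \<open>u'\<close> see any vertex
          outside it in the same color, which would have to be both \<open>a\<close> and
          \<open>b\<close>.\<close>
        proof (cases "(u, u') \<in> (color_rel W f c)\<^sup>*")
          case False
          then have "(u', u) \<notin> (color_rel W f c)\<^sup>*" using sym_color_rel by (meson symD)
          then have "f {u', u} = b" using forced[of b u' u] ab u u' by simp
          moreover have "f {u, u'} = a" using forced[of a u u'] ab u u' False by simp
          ultimately show False using ab by (simp add: insert_commute)
        next
          case True
          obtain w where w: "w \<in> W" "(u, w) \<notin> (color_rel W f c)\<^sup>*"
            using nxy x y sym_color_rel by (meson rtrancl_trans symD)
          then have "(u', w) \<notin> (color_rel W f c)\<^sup>*"
            using True by (meson rtrancl_trans)
          then have "f {u', w} = b" using forced[of b u' w] ab u' w by simp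
          moreover have "f {u, w} = a" using forced[of a u w] ab u w by simp
          moreover have "f {u', w} = f {u, w}"
            using component_mono[OF gW True u(1) w] by simp
          ultimately show False using ab by simp
        qed
      qed
    qed
  qed
qed

text \<open>The parts are the components of a color that Gallai's lemma leaves disconnected;
  \<open>component_mono2\<close> makes each pair of them monochromatic.\<close>

lemma gallai_mono_partition:
  assumes g: "gallai_on V f" and "card V \<ge> 2"
  obtains c \<P> where "c \<in> {1, 2, 3}" "mono_partition V f c \<P>" "\<exists>P\<in>\<P>. \<exists>Q\<in>\<P>. P \<noteq> Q"
proof -
  obtain c x y where c: "c \<in> {1, 2, 3}" and x: "x \<in> V" and y: "y \<in> V"
    and n: "(x, y) \<notin> (color_rel V f c)\<^sup>*"
    using gallai_disconnected_color[OF assms] by blast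
  \<comment> \<open>The reflexive closure relates every element of the type to itself, so it is
    restricted to \<open>V\<close> to become an equivalence on \<open>V\<close>.\<close>
  define E where "E = (color_rel V f c)\<^sup>* \<inter> V \<times> V"
  have E: "equiv V E"
  proof (rule equivI)
    show "refl_on V E" by (auto simp: E_def refl_on_def)
    show "sym E" using sym_color_rel[of V f c] by (auto simp: E_def sym_def)
    show "trans E" by (auto simp: E_def trans_def)
    show "E \<subseteq> V \<times> V" by (auto simp: E_def)
  qed
  have "\<exists>d\<in>{1, 2, 3} - {c}. \<forall>s\<in>P. \<forall>t\<in>Q. f {s, t} = d"
    if h: "P \<in> V // E" "Q \<in> V // E" "P \<noteq> Q" for P Q
  proof -
    obtain p q where p: "p \<in> V" "P = E `` {p}" and q: "q \<in> V" "Q = E `` {q}"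
      using h by (meson quotientE)
    have "(p, q) \<notin> E" using h p q equiv_class_eq[OF E] by blast
    then have npq: "(p, q) \<notin> (color_rel V f c)\<^sup>*" using p q by (auto simp: E_def)
    have "f {s, t} = f {p, q}" if "s \<in> P" "t \<in> Q" for s t
    proof (rule component_mono2(1)[OF g _ _ p(1) q(1) npq])
      show "(p, s) \<in> (color_rel V f c)\<^sup>*" "(q, t) \<in> (color_rel V f c)\<^sup>*"
        using that unfolding p(2) q(2) by (simp_all add: E_def)
    qed
    moreover have "f {p, q} \<noteq> c" "p \<noteq> q"
      using component_mono2[OF g rtrancl_refl rtrancl_refl p(1) q(1) npq] by simp_all
    ultimately show ?thesis using gallai_on_color[OF g p(1) q(1)] by blast
  qed
  then have "mono_partition V f c (V // E)"
    unfolding mono_partition_def using partition_on_quotient[OF E] by blast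
  moreover have "E `` {x} \<noteq> E `` {y}"
    using n eq_equiv_class[OF _ E y, of x] by (auto simp: E_def)
  ultimately show ?thesis using that[OF c] quotientI x y by metis
qed

section \<open>The two-colored quotient of a partition\<close>

text \<open>Arbitrary representatives suffice: between distinct parts of a
  \<open>mono_partition\<close> the color does not depend on them.\<close>

definition part_color :: "('a set \<Rightarrow> nat) \<Rightarrow> 'a set \<Rightarrow> 'a set \<Rightarrow> nat" where
  "part_color f R S = f {SOME x. x \<in> R, SOME y. y \<in> S}"

lemma part_color_sym: "part_color f R S = part_color f S R"
  by (simp add: part_color_def insert_commute)

lemma part_color:
  assumes P: "mono_partition V f c \<P>" and h: "R \<in> \<P>" "S \<in> \<P>" "R \<noteq> S"
  shows "part_color f R S \<in> {1, 2, 3} - {c} \<and> (\<forall>x\<in>R. \<forall>y\<in>S. f {x, y} = part_color f R S)"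
proof -
  obtain e where e: "e \<in> {1, 2, 3} - {c}" "\<forall>x\<in>R. \<forall>y\<in>S. f {x, y} = e"
    using P h unfolding mono_partition_def by meson
  have "R \<noteq> {}" "S \<noteq> {}" using P h partition_onD3 by (auto simp: mono_partition_def)
  then have "(SOME x. x \<in> R) \<in> R" "(SOME x. x \<in> S) \<in> S" by (auto simp: some_in_eq)
  then have "part_color f R S = e" using e by (simp add: part_color_def)
  then show ?thesis using e by simp
qed

text \<open>Otherwise \<open>R\<close> and the union of the remaining parts form a monochromatic
  cut.\<close>

lemma part_color_not_constant:
  assumes P: "mono_partition V f c \<P>" and nc: "\<not> mono_cut V f"
    and h: "R \<in> \<P>" "\<P> - {R} \<noteq> {}"
  shows "\<not> (\<forall>S\<in>\<P> - {R}. part_color f R S = e)"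
proof
  have part: "partition_on V \<P>" using P by (simp add: mono_partition_def)
  have ne: "R \<noteq> {}" if "R \<in> \<P>" for R using partition_onD3[OF part] that by auto
  have un: "\<Union>\<P> = V" using partition_onD1[OF part] by simp
  have dj: "R \<inter> S = {}" if "R \<in> \<P>" "S \<in> \<P>" "R \<noteq> S" for R S
    using partition_onD2[OF part] that by (auto simp: disjoint_def)
  assume a: "\<forall>S\<in>\<P> - {R}. part_color f R S = e"
  have "f {x, y} = e" if "x \<in> R" "y \<in> \<Union>(\<P> - {R})" for x y
  proof -
    obtain S where S: "S \<in> \<P>" "R \<noteq> S" "y \<in> S" using \<open>y \<in> _\<close> by auto
    then have "f {x, y} = part_color f R S" using part_color[OF P h(1) S(1,2)] \<open>x \<in> R\<close> by simp
    then show ?thesis using a S by simp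
  qed
  moreover have "R \<inter> \<Union>(\<P> - {R}) = {}" using dj h by blast
  moreover have "R \<union> \<Union>(\<P> - {R}) = V" using un h(1) by blast
  moreover have "\<Union>(\<P> - {R}) \<noteq> {}" using ne h(2) by blast
  ultimately have "mono_cut V f"
    using ne[OF h(1)] unfolding mono_cut_def
    by (intro exI[of _ R] exI[of _ "\<Union>(\<P> - {R})"] exI[of _ e]) simp
  then show False using nc by simp
qed

text \<open>The variables are the edges of a two-colored K_4 on A, B, C, X: \<open>p\<close>,
  \<open>q\<close>, \<open>r\<close> stand for AB, AC, BC and \<open>x\<close>, \<open>y\<close>,
  \<open>z\<close> for AX, BX, CX. At each vertex one edge differs from the other two. If at A, B
  and C this were always the edge to X, then \<open>p\<close>, \<open>q\<close>, \<open>r\<close>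
  would agree and \<open>x\<close>, \<open>y\<close>, \<open>z\<close> would all be their negation,
  making X monochromatic.\<close>

lemma odd_one_out:
  fixes p q r x y z :: bool
  assumes "\<not> (p = q \<and> p = x)" "\<not> (p = r \<and> p = y)" "\<not> (q = r \<and> q = z)" "\<not> (x = y \<and> x = z)"
  shows "p \<noteq> q \<and> p \<noteq> x \<or> q \<noteq> p \<and> q \<noteq> x \<or> p \<noteq> r \<and> p \<noteq> y \<or> r \<noteq> p \<and> r \<noteq> y \<or>
    q \<noteq> r \<and> q \<noteq> z \<or> r \<noteq> q \<and> r \<noteq> z"
  using assms by (cases p; cases q; cases r; cases x; cases y; cases z; simp)

text \<open>
  With four parts, the absence of a monochromatic cut makes the two colors complementary paths on
  the parts, and \<open>P\<close> is an end of the path in color \<open>a\<close>, with neighbor \<open>Q\<close>. Both can be chosen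
  different from any given part \<open>X\<close>.
\<close>

lemma path_end_among_four_parts:
  assumes P: "mono_partition V f c \<P>" and c: "c \<in> {1, 2, 3}" and nc: "\<not> mono_cut V f"
    and eq: "\<P> = {A, B, C, X}" and d: "distinct [A, B, C, X]"
  shows "\<exists>P\<in>{A, B, C}. \<exists>Q\<in>{A, B, C} - {P}. \<exists>a\<in>{1, 2, 3} - {c}.
    \<forall>x\<in>P. \<forall>z\<in>V - P. f {x, z} \<noteq> c \<and> (f {x, z} = a \<longrightarrow> z \<in> Q)"
proof -
  have un: "\<Union>\<P> = V" using P partition_onD1 by (auto simp: mono_partition_def)
  let ?g = "part_color f"
  note gs = part_color_sym[of f] and gp = part_color[OF P] and mixed = part_color_not_constant[OF P nc]
  obtain a b where ab: "a \<noteq> b" "a \<noteq> c" "b \<noteq> c" "{1, 2, 3} = {a, b, c}"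
    using other_colors[OF c] .
  have two: "?g R S = a \<or> ?g R S = b" if "R \<in> \<P>" "S \<in> \<P>" "R \<noteq> S" for R S
    using gp[OF that] unfolding ab(4) by auto
  have m: "\<not> (?g A B = e \<and> ?g A C = e \<and> ?g A X = e)" "\<not> (?g A B = e \<and> ?g B C = e \<and> ?g B X = e)"
     "\<not> (?g A C = e \<and> ?g B C = e \<and> ?g C X = e)" for e
  proof -
    have "\<P> - {A} = {B, C, X}" "\<P> - {B} = {A, C, X}" "\<P> - {C} = {A, B, X}"
      using d by (auto simp: eq)
    note s = this
    show "\<not> (?g A B = e \<and> ?g A C = e \<and> ?g A X = e)" using mixed[of A e] unfolding s by (simp add: eq)
    show "\<not> (?g A B = e \<and> ?g B C = e \<and> ?g B X = e)"
      using mixed[of B e] unfolding s gs[of A B] by (simp add: eq)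
    show "\<not> (?g A C = e \<and> ?g B C = e \<and> ?g C X = e)"
      using mixed[of C e] unfolding s gs[of A C] gs[of B C] by (simp add: eq)
  qed
  have mX: "\<not> (?g A X = e \<and> ?g B X = e \<and> ?g C X = e)" for e
  proof -
    have s: "\<P> - {X} = {A, B, C}" using d by (auto simp: eq)
    show ?thesis using mixed[of X e] unfolding s gs[of A X] gs[of B X] gs[of C X] by (simp add: eq)
  qed
  have t: "?g A B = a \<or> ?g A B = b" "?g A C = a \<or> ?g A C = b" "?g A X = a \<or> ?g A X = b"
     "?g B C = a \<or> ?g B C = b" "?g B X = a \<or> ?g B X = b" "?g C X = a \<or> ?g C X = b"
    using two[of A B] two[of A C] two[of A X] two[of B C] two[of B X] two[of C X] d
    by (simp_all add: eq)
  \<comment> \<open>It suffices that the color of \<open>P Q\<close> differs from those of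
    \<open>P R\<close> and \<open>P S\<close>: then \<open>Q\<close> is the only part that
    \<open>P\<close> sees in this color.\<close>
  have *: ?thesis if h: "{P, Q, R, S} = {A, B, C, X}" "P \<in> {A, B, C}" "Q \<in> {A, B, C}" "distinct [P, Q, R, S]"
     "?g P Q \<noteq> ?g P R" "?g P Q \<noteq> ?g P S" for P Q R S
  proof -
    have PP: "\<P> = {P, Q, R, S}" using h eq by simp
    have "f {x, z} \<noteq> c \<and> (f {x, z} = ?g P Q \<longrightarrow> z \<in> Q)" if xz: "x \<in> P" "z \<in> V - P" for x z
    proof -
      obtain T where T: "T \<in> \<P>" "z \<in> T" using un xz by blast
      then have "T \<noteq> P" using xz by auto
      then have "f {x, z} = ?g P T" "?g P T \<noteq> c" using gp[of P T] T xz PP by auto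
      moreover have "?g P T = ?g P Q \<longrightarrow> T = Q" using T \<open>T \<noteq> P\<close> PP \<open>?g P Q \<noteq> ?g P R\<close> \<open>?g P Q \<noteq> ?g P S\<close> by auto
      ultimately show ?thesis using T by auto
    qed
    moreover have "?g P Q \<in> {1, 2, 3} - {c}" using gp[of P Q] PP h(4) by simp
    moreover have "Q \<in> {A, B, C} - {P}" using h(3,4) by auto
    ultimately show ?thesis using h(2) by (intro bexI[of _ P] bexI[of _ Q] bexI[of _ "?g P Q"]) auto
  qed
  \<comment> \<open>With only two colors between parts, each part color is encoded by whether it
    equals \<open>a\<close>.\<close>
  have q: "\<not> ((?g A B = a) = (?g A C = a) \<and> (?g A B = a) = (?g A X = a))"
    using m(1)[of a] m(1)[of b] t by metis
  have q': "\<not> ((?g A B = a) = (?g B C = a) \<and> (?g A B = a) = (?g B X = a))"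
    using m(2)[of a] m(2)[of b] t by metis
  have q'': "\<not> ((?g A C = a) = (?g B C = a) \<and> (?g A C = a) = (?g C X = a))"
    using m(3)[of a] m(3)[of b] t by metis
  have "\<not> ((?g A X = a) = (?g B X = a) \<and> (?g A X = a) = (?g C X = a))"
    using mX[of a] mX[of b] t by metis
  from odd_one_out[OF q q' q'' this]
  consider "?g A B \<noteq> ?g A C" "?g A B \<noteq> ?g A X" | "?g A C \<noteq> ?g A B" "?g A C \<noteq> ?g A X"
    | "?g B A \<noteq> ?g B C" "?g B A \<noteq> ?g B X" | "?g B C \<noteq> ?g B A" "?g B C \<noteq> ?g B X"
    | "?g C A \<noteq> ?g C B" "?g C A \<noteq> ?g C X" | "?g C B \<noteq> ?g C A" "?g C B \<noteq> ?g C X"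
    unfolding gs[of B A] gs[of C A] gs[of C B] by metis
  then show ?thesis
  proof cases
    case 1
    show ?thesis by (rule *[of A B C X]) (use d 1 in auto)
  next
    case 2
    show ?thesis by (rule *[of A C B X]) (use d 2 in auto)
  next
    case 3
    show ?thesis by (rule *[of B A C X]) (use d 3 in auto)
  next
    case 4
    show ?thesis by (rule *[of B C A X]) (use d 4 in auto)
  next
    case 5
    show ?thesis by (rule *[of C A B X]) (use d 5 in auto)
  next
    case 6
    show ?thesis by (rule *[of C B A X]) (use d 6 in auto)
  qed
qed

text \<open>Five parts would give \<open>5 * k \<le> 2 * card V\<close> by summing around a cycle,
  and with two or three parts some part sees all others in one color. So there are four. Two parts
  of size at least 4 would leave two others of total size at least \<open>k\<close>, against
  \<open>card V < k + 8\<close>; hence three parts have size at most 3, and \<open>P\<close> and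
  \<open>Q\<close> are taken among these.\<close>

lemma small_path_end:
  assumes fin: "finite V" and P: "mono_partition V f c \<P>" and c: "c \<in> {1, 2, 3}"
    and nc: "\<not> mono_cut V f" and two: "\<exists>P\<in>\<P>. \<exists>Q\<in>\<P>. P \<noteq> Q"
    and k: "\<And>P Q. P \<in> \<P> \<Longrightarrow> Q \<in> \<P> \<Longrightarrow> P \<noteq> Q \<Longrightarrow> k \<le> card P + card Q"
    and V: "2 * card V < 5 * k" "card V < k + 8"
  shows "\<exists>P\<in>\<P>. \<exists>Q\<in>\<P> - {P}. \<exists>a\<in>{1, 2, 3} - {c}. card P \<le> 3 \<and> card Q \<le> 3 \<and>
    (\<forall>x\<in>P. \<forall>z\<in>V - P. f {x, z} \<noteq> c \<and> (f {x, z} = a \<longrightarrow> z \<in> Q))"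
proof -
  have part: "partition_on V \<P>" using P by (simp add: mono_partition_def)
  have finP: "finite \<P>" using finite_elements[OF fin part] .
  have sum_le: "sum card S \<le> card V" if "S \<subseteq> \<P>" for S
  proof -
    have "pairwise disjnt S"
      using partition_onD2[OF part] that by (auto simp: disjoint_def pairwise_def disjnt_def)
    moreover have "\<Union>S \<subseteq> V" using partition_onD1[OF part] that by auto
    moreover have "finite R" if "R \<in> S" for R
      using \<open>\<Union>S \<subseteq> V\<close> fin that by (meson Union_upper finite_subset)
    ultimately show ?thesis using card_mono[OF fin, of "\<Union>S"] card_Union_disjoint[of S] by simp
  qed
  have "\<not> card \<P> \<ge> 5"
  proof
    assume "card \<P> \<ge> 5"
    then obtain S where S: "S \<subseteq> \<P>" "card S = 5" by (meson obtain_subset_with_card_n)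
    then obtain xs where xs: "set xs = S" "distinct xs" "length xs = 5"
      using finP by (metis distinct_card finite_distinct_list finite_subset)
    then obtain A B C D E where "xs = [A, B, C, D, E]"
      by (auto simp: length_Suc_conv numeral_eq_Suc)
    then have e: "S = {A, B, C, D, E}" "distinct [A, B, C, D, E]" using xs by auto
    have "card A + card B + card C + card D + card E \<le> card V" using sum_le[OF S(1)] e by simp
    moreover have "k \<le> card A + card B" "k \<le> card B + card C" "k \<le> card C + card D"
      "k \<le> card D + card E" "k \<le> card A + card E"
      using k S e by simp_all
    ultimately show False using V by linarith
  qed
  let ?g = "part_color f"
  note gs = part_color_sym[of f] and gp = part_color[OF P] and mixed = part_color_not_constant[OF P nc]
  have "card \<P> \<noteq> 2"
  proof
    assume "card \<P> = 2"
    then obtain A B where "\<P> = {A, B}" "A \<noteq> B" by (meson card_2_iff)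
    then have "\<P> - {A} = {B}" "A \<in> \<P>" by auto
    then show False using mixed[of A "?g A B"] by simp
  qed
  moreover have "card \<P> \<noteq> 3"
  proof
    assume "card \<P> = 3"
    then obtain A B C where e: "\<P> = {A, B, C}" "A \<noteq> B" "A \<noteq> C" "B \<noteq> C"
      by (meson card_3_iff)
    have r: "\<P> - {A} = {B, C}" "\<P> - {B} = {A, C}" "\<P> - {C} = {A, B}" using e by auto
    have "?g A B \<noteq> ?g A C" using mixed[of A "?g A B"] unfolding r by (auto simp: e)
    moreover have "?g A B \<noteq> ?g B C"
      using mixed[of B "?g A B"] gs[of A B] unfolding r by (auto simp: e)
    moreover have "?g A C \<noteq> ?g B C"
      using mixed[of C "?g A C"] gs[of A C] gs[of B C] unfolding r by (auto simp: e)
    moreover have "?g A B \<in> {1, 2, 3} - {c}" "?g A C \<in> {1, 2, 3} - {c}" "?g B C \<in> {1, 2, 3} - {c}"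
      using gp[of A B] gp[of A C] gp[of B C] e by simp_all
    ultimately show False using c by auto
  qed
  moreover have "\<not> card \<P> \<le> 1"
    using two finP by (auto simp: card_le_Suc0_iff_eq)
  ultimately have "card \<P> = 4" using \<open>\<not> card \<P> \<ge> 5\<close> by linarith
  then obtain xs where xs: "set xs = \<P>" "distinct xs" "length xs = 4"
    using finP by (metis distinct_card finite_distinct_list)
  then obtain A B C D where "xs = [A, B, C, D]"
    by (auto simp: length_Suc_conv numeral_eq_Suc)
  then have e: "\<P> = {A, B, C, D}" "distinct [A, B, C, D]" using xs by auto
  have *: ?thesis if e': "\<P> = {A, B, C, X}" "distinct [A, B, C, X]"
    and s: "card A \<le> 3" "card B \<le> 3" "card C \<le> 3" for A B C X
  proof -
    obtain P Q a where PQ: "P \<in> {A, B, C}" "Q \<in> {A, B, C} - {P}" and a: "a \<in> {1, 2, 3} - {c}"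
      "\<forall>x\<in>P. \<forall>z\<in>V - P. f {x, z} \<noteq> c \<and> (f {x, z} = a \<longrightarrow> z \<in> Q)"
      using path_end_among_four_parts[OF P c nc e'] by meson
    have "P \<in> \<P>" "Q \<in> \<P> - {P}" using PQ unfolding e' by blast+
    moreover have "card P \<le> 3" "card Q \<le> 3" using PQ s by blast+
    ultimately show ?thesis using a by (intro bexI[of _ P] bexI[of _ Q] bexI[of _ a]) simp_all
  qed
  have "card A + card B + card C + card D \<le> card V" using sum_le[of \<P>] e by simp
  moreover have "k \<le> card A + card B" "k \<le> card A + card C" "k \<le> card A + card D"
    "k \<le> card B + card C" "k \<le> card B + card D" "k \<le> card C + card D"
    using k e by simp_all
  ultimately consider "card A \<le> 3" "card B \<le> 3" "card C \<le> 3" | "card A \<le> 3" "card B \<le> 3" "card D \<le> 3"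
    | "card A \<le> 3" "card C \<le> 3" "card D \<le> 3" | "card B \<le> 3" "card C \<le> 3" "card D \<le> 3"
    using V by linarith
  then show ?thesis
  proof cases
    case 1
    show ?thesis by (rule *[of A B C D]) (use e 1 in auto)
  next
    case 2
    show ?thesis by (rule *[of A B D C]) (use e 2 in auto)
  next
    case 3
    show ?thesis by (rule *[of A C D B]) (use e 3 in auto)
  next
    case 4
    show ?thesis by (rule *[of B C D A]) (use e 4 in auto)
  qed
qed

section \<open>The bound for R(3,3) and the richness condition\<close>

text \<open>With six vertices, \<open>x\<close> is joined to three others in one color. An edge of
  that color among the three closes a triangle with \<open>x\<close>; otherwise they form a triangle
  in the other color.\<close>

lemma no_mono_triangle_less_6:
  fixes f :: "'a set \<Rightarrow> nat"
  assumes fin: "finite A" and x: "x \<in> A" and ab: "a \<noteq> b"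
    and col: "\<And>y z. y \<in> A \<Longrightarrow> z \<in> A \<Longrightarrow> y \<noteq> z \<Longrightarrow> f {y, z} \<in> {a, b}"
    and tri: "\<And>y z w. y \<in> A \<Longrightarrow> z \<in> A \<Longrightarrow> w \<in> A \<Longrightarrow> distinct [y, z, w] \<Longrightarrow>
      \<not> (f {y, z} = f {y, w} \<and> f {y, z} = f {z, w})"
  shows "card A < 6"
proof (rule ccontr)
  assume n: "\<not> card A < 6"
  have "A = insert x (nbr A f a x \<union> nbr A f b x)"
    using x col[OF x] by (fastforce simp: nbr_iff)
  then have "card A = card (insert x (nbr A f a x \<union> nbr A f b x))" by (rule arg_cong)
  also have "\<dots> \<le> Suc (card (nbr A f a x \<union> nbr A f b x))" using fin by (simp add: card_insert_if)
  also have "\<dots> \<le> Suc (card (nbr A f a x) + card (nbr A f b x))" using card_Un_le by simp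
  finally have "card A \<le> Suc (card (nbr A f a x) + card (nbr A f b x))" .
  then have "3 \<le> card (nbr A f a x) \<or> 3 \<le> card (nbr A f b x)"
    using n by linarith
  then obtain c where c: "c \<in> {a, b}" "3 \<le> card (nbr A f c x)" by blast
  then obtain S where S: "S \<subseteq> nbr A f c x" "card S = 3" by (meson obtain_subset_with_card_n)
  then obtain u v w where "S = {u, v, w}" "u \<noteq> v" "u \<noteq> w" "v \<noteq> w" by (meson card_3_iff)
  then have uvw: "distinct [u, v, w]" "u \<in> nbr A f c x" "v \<in> nbr A f c x" "w \<in> nbr A f c x"
    using S by auto
  then have e: "u \<in> A" "v \<in> A" "w \<in> A" "x \<noteq> u" "x \<noteq> v" "x \<noteq> w"
    "f {x, u} = c" "f {x, v} = c" "f {x, w} = c"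
    by (auto simp: nbr_iff)
  have "f {u, v} \<noteq> c" "f {u, w} \<noteq> c" "f {v, w} \<noteq> c"
    using tri[of x u v] tri[of x u w] tri[of x v w] e uvw(1) x by auto
  moreover have "f {u, v} \<in> {a, b}" "f {u, w} \<in> {a, b}" "f {v, w} \<in> {a, b}"
    using col e uvw(1) by auto
  ultimately show False using tri[of u v w] e uvw(1) c by auto
qed

text \<open>
  The condition on a coloring which remains when there are no books with few colors: an edge has
  at least \<open>k\<close> pages on which a given color different from its own appears.
\<close>

definition rich :: "'a set \<Rightarrow> ('a set \<Rightarrow> nat) \<Rightarrow> nat \<Rightarrow> bool" where
  "rich V f k \<longleftrightarrow> (\<forall>x\<in>V. \<forall>y\<in>V. \<forall>b\<in>{1, 2, 3}. x \<noteq> y \<longrightarrow> b \<noteq> f {x, y} \<longrightarrow>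
     k \<le> card (nbr V f b x \<union> nbr V f b y))"

lemma richD: "rich V f k \<Longrightarrow> x \<in> V \<Longrightarrow> y \<in> V \<Longrightarrow> x \<noteq> y \<Longrightarrow> b \<in> {1, 2, 3} \<Longrightarrow> b \<noteq> f {x, y} \<Longrightarrow>
    k \<le> card (nbr V f b x \<union> nbr V f b y)"
  unfolding rich_def by blast

lemma rich_card_le:
  assumes "rich V f k" "x \<in> V" "y \<in> V" "x \<noteq> y" "b \<in> {1, 2, 3}" "b \<noteq> f {x, y}"
    and "nbr V f b x \<union> nbr V f b y \<subseteq> S" "finite S"
  shows "k \<le> card S"
  using richD[OF assms(1-6)] card_mono[OF assms(8,7)] by simp

text \<open>Color \<open>c\<close> does not leave \<open>P\<close> and is not the color of
  \<open>x y\<close>, so all \<open>c\<close>-neighbors counted lie in \<open>P - {x, y}\<close>.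
  This will force edges inside small parts to have color \<open>c\<close>.\<close>

lemma small_part_contradiction:
  assumes fin: "finite P" and P: "P \<subseteq> V" "card P \<le> 3" and xy: "x \<in> P" "y \<in> P" "x \<noteq> y"
    and ne: "\<And>x z. x \<in> P \<Longrightarrow> z \<in> V - P \<Longrightarrow> f {x, z} \<noteq> c"
    and c: "c \<noteq> f {x, y}"
    and k: "k \<le> card (nbr V f c x \<union> nbr V f c y)"
  shows "k \<le> 1"
proof -
  have "c \<noteq> f {y, x}" using c by (simp add: insert_commute)
  then have "nbr V f c x \<union> nbr V f c y \<subseteq> P - {x, y}"
    using ne xy(1,2) c unfolding nbr_def by blast
  then have "card (nbr V f c x \<union> nbr V f c y) \<le> card (P - {x, y})"
    using fin by (intro card_mono) auto
  also have "\<dots> \<le> 1" using P xy by simp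
  finally show ?thesis using k by simp
qed

lemma mono_partition_part:
  assumes "mono_partition V f c \<P>" "finite V" "P \<in> \<P>"
  shows "P \<subseteq> V" "P \<noteq> {}" "finite P"
proof -
  have part: "partition_on V \<P>" using assms by (simp add: mono_partition_def)
  show "P \<subseteq> V" using assms partition_onD1[OF part] by auto
  then show "finite P" using assms finite_subset by auto
  show "P \<noteq> {}" using assms partition_onD3[OF part] by auto
qed

lemma mono_partition_outside:
  assumes P: "mono_partition V f c \<P>" and h: "P \<in> \<P>" "x \<in> P" "z \<in> V - P"
  shows "f {x, z} \<noteq> c"
proof -
  obtain Q where Q: "Q \<in> \<P>" "z \<in> Q"
    using h P partition_onD1 by (fastforce simp: mono_partition_def)
  then have "P \<noteq> Q" using h by auto
  then show ?thesis using part_color[OF P h(1) Q(1)] h Q by auto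
qed

text \<open>The \<open>c\<close>-neighbors of \<open>x\<close> stay in \<open>P - {x}\<close> and
  those of \<open>y\<close> in \<open>Q - {y}\<close>. A lower bound on their number thus becomes a
  lower bound on the sizes of two parts.\<close>

lemma mono_partition_pair:
  assumes P: "mono_partition V f c \<P>" and fin: "finite V"
    and PQ: "P \<in> \<P>" "Q \<in> \<P>" "P \<noteq> Q" and xy: "x \<in> P" "y \<in> Q"
  shows "x \<noteq> y" "c \<noteq> f {x, y}" "card (nbr V f c x \<union> nbr V f c y) + 2 \<le> card P + card Q"
proof -
  have "P \<inter> Q = {}"
    using P PQ partition_onD2 by (fastforce simp: mono_partition_def disjoint_def)
  then have d: "y \<notin> P" "x \<noteq> y" using xy by auto
  note subP = mono_partition_part[OF P fin PQ(1)] and subQ = mono_partition_part[OF P fin PQ(2)]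
  note out = mono_partition_outside[OF P]
  show "x \<noteq> y" by fact
  show "c \<noteq> f {x, y}" using out[OF PQ(1) xy(1), of y] subQ xy d by auto
  have "nbr V f c x \<union> nbr V f c y \<subseteq> (P - {x}) \<union> (Q - {y})"
    using out PQ xy unfolding nbr_def by blast
  then have "card (nbr V f c x \<union> nbr V f c y) \<le> card ((P - {x}) \<union> (Q - {y}))"
    using subP subQ by (intro card_mono) auto
  also have "\<dots> \<le> card (P - {x}) + card (Q - {y})" by (rule card_Un_le)
  finally have "card (nbr V f c x \<union> nbr V f c y) \<le> card (P - {x}) + card (Q - {y})" .
  moreover have "0 < card P" "0 < card Q" using subP subQ by (simp_all add: card_gt_0_iff)
  ultimately show "card (nbr V f c x \<union> nbr V f c y) + 2 \<le> card P + card Q"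
    using xy by (simp add: card_Diff_singleton)
qed

section \<open>Thirteen vertices without a monochromatic cut\<close>

text \<open>The path end \<open>P\<close> has three vertices and only \<open>c\<close>-edges inside.
  The \<open>a\<close>-neighbors of two of its vertices therefore all lie in \<open>Q\<close>, which
  has at most three vertices, while richness asks for four.\<close>

lemma no_rich_without_mono_cut:
  assumes g: "gallai_on V f" and r: "rich V f 4" and V: "card V = 13" and nc: "\<not> mono_cut V f"
  shows False
proof -
  note fin = gallai_on_finite[OF g]
  obtain c \<P> where c: "c \<in> {1, 2, 3}" and P: "mono_partition V f c \<P>"
    and two: "\<exists>P\<in>\<P>. \<exists>Q\<in>\<P>. P \<noteq> Q"
    using gallai_mono_partition[OF g] V by auto
  \<comment> \<open>Four neighbors plus the two vertices \<open>x\<close> and \<open>y\<close>. With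
    this bound 26 < 30 and 13 < 14, as \<open>small_path_end\<close> requires.\<close>
  have k: "6 \<le> card P + card Q" if PQ: "P \<in> \<P>" "Q \<in> \<P>" "P \<noteq> Q" for P Q
  proof -
    obtain x y where xy: "x \<in> P" "y \<in> Q"
      using mono_partition_part(2)[OF P fin] PQ by blast
    note p = mono_partition_pair[OF P fin PQ xy]
    have "x \<in> V" "y \<in> V" using mono_partition_part(1)[OF P fin] PQ xy by blast+
    then have "4 \<le> card (nbr V f c x \<union> nbr V f c y)" using richD[OF r _ _ p(1) c] p(2) by simp
    then show ?thesis using p(3) by linarith
  qed
  obtain P Q a where PQ: "P \<in> \<P>" "Q \<in> \<P> - {P}" and a: "a \<in> {1, 2, 3} - {c}"
    and s: "card P \<le> 3" "card Q \<le> 3"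
    and o: "\<forall>x\<in>P. \<forall>z\<in>V - P. f {x, z} \<noteq> c \<and> (f {x, z} = a \<longrightarrow> z \<in> Q)"
    using small_path_end[OF fin P c nc two k] V by auto
  have "P \<noteq> Q" using PQ(2) by blast
  then have "6 \<le> card P + card Q" using k PQ by simp
  then have "card P = 3" using s by linarith
  then obtain x y where xy: "x \<in> P" "y \<in> P" "x \<noteq> y" by (metis card_3_iff insertCI)
  have inner: "f {x, y} = c" if "x \<in> P" "y \<in> P" "x \<noteq> y" for x y
  proof (rule ccontr)
    assume "f {x, y} \<noteq> c"
    then have "4 \<le> card (nbr V f c x \<union> nbr V f c y)"
      using richD[OF r _ _ that(3) c] mono_partition_part(1)[OF P fin PQ(1)] that(1,2) by fastforce
    then have "(4::nat) \<le> 1"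
      using small_part_contradiction[OF mono_partition_part(3,1)[OF P fin PQ(1)] s(1) that, of f c 4]
        mono_partition_outside[OF P PQ(1)]
        \<open>f {x, y} \<noteq> c\<close> by auto
    then show False by simp
  qed
  have Q: "finite Q" "P \<subseteq> V" using mono_partition_part[OF P fin] PQ by auto
  have "nbr V f a x \<union> nbr V f a y \<subseteq> Q"
    using xy inner o a unfolding nbr_def by blast
  then have "4 \<le> card Q"
    using rich_card_le[OF r _ _ xy(3), of a Q] xy(1,2) inner[OF xy] a Q by fastforce
  then show False using s by simp
qed

section \<open>Thirteen vertices with a monochromatic cut\<close>

text \<open>If \<open>A\<close> had two vertices, it would contain an edge of color other than
  \<open>d\<close>. This property spreads to all edges of \<open>A\<close>, which would then be
  two-colored without a monochromatic triangle. So \<open>A\<close> has fewer than six vertices,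
  whereas a third vertex would force exactly six; and two vertices alone are too few for
  richness.\<close>

lemma small_side_singleton:
  assumes g: "gallai_on V f" and r: "rich V f 4" and AB: "A \<union> B = V" "A \<inter> B = {}"
    and d: "\<forall>x\<in>A. \<forall>y\<in>B. f {x, y} = d" and A: "card A \<le> 6" and xy: "x \<in> A" "y \<in> A"
    and dc: "d \<in> {1, 2, 3}"
  shows "x = y"
proof (rule ccontr)
  assume "x \<noteq> y"
  have fin: "finite V" "finite A" using gallai_on_finite[OF g] AB by auto
  have nb: "nbr V f e x \<union> nbr V f e y \<subseteq> A - {x, y}"
    if h: "e \<noteq> d" "e \<noteq> f {x, y}" "x \<in> A" "y \<in> A" for e x y
  proof -
    have "e \<noteq> f {y, x}" using h by (simp add: insert_commute)
    then show ?thesis using h AB d by (auto simp: nbr_iff)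
  qed
  \<comment> \<open>For the third color \<open>e\<close>, the four required
    \<open>e\<close>-neighbors of \<open>x\<close> and \<open>y\<close> lie in
    \<open>A - {x, y}\<close>, hence fill it, and \<open>A\<close> has six vertices. So
    \<open>z\<close> is joined to \<open>x\<close> or \<open>y\<close> in color \<open>e\<close>,
    and the absence of rainbow triangles settles the remaining edge.\<close>
  have star: "f {x, z} \<noteq> d \<and> f {y, z} \<noteq> d \<and> \<not> (f {x, y} = f {x, z} \<and> f {x, y} = f {y, z}) \<and> card A = 6"
    if h: "x \<in> A" "y \<in> A" "z \<in> A" "x \<noteq> y" "x \<noteq> z" "y \<noteq> z" "f {x, y} \<noteq> d" for x y z
  proof -
    have hV: "x \<in> V" "y \<in> V" "z \<in> V" using h AB by auto
    have col: "f {x, y} \<in> {1, 2, 3}" using gallai_on_color[OF g] h AB by auto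
    obtain e where e: "e \<in> {1, 2, 3}" "e \<noteq> d" "e \<noteq> f {x, y}"
      using third_color[OF dc col] h by metis
    have sub: "nbr V f e x \<union> nbr V f e y \<subseteq> A - {x, y}" using nb e h by simp
    have "4 \<le> card (nbr V f e x \<union> nbr V f e y)" using richD[OF r] h AB e by auto
    moreover have "card (A - {x, y}) = card A - 2" using h by (simp add: card_Diff_subset)
    moreover have "card (nbr V f e x \<union> nbr V f e y) \<le> card (A - {x, y})"
      using sub fin by (intro card_mono) auto
    ultimately have c: "card A = 6" "card (A - {x, y}) \<le> card (nbr V f e x \<union> nbr V f e y)" using A by auto
    have "nbr V f e x \<union> nbr V f e y = A - {x, y}"
      using c(2) card_seteq[OF _ sub] fin by simp
    moreover have "z \<in> A - {x, y}" using h by simp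
    ultimately have "z \<in> nbr V f e x \<union> nbr V f e y" by simp
    then have "f {x, z} = e \<or> f {y, z} = e" unfolding nbr_def by blast
    moreover have "f {x, y} = f {x, z} \<or> f {x, y} = f {y, z} \<or> f {x, z} = f {y, z}"
      using gallai_on_triangle[OF g, of x y z] h hV by simp
    ultimately show ?thesis using e h c by auto
  qed
  obtain u v where uv: "u \<in> A" "v \<in> A" "u \<noteq> v" "f {u, v} \<noteq> d"
  proof (cases "f {x, y} = d")
    case True
    obtain a where a: "a \<in> {1, 2, 3}" "a \<noteq> d" using other_colors[OF dc] by (metis insertI1)
    then have "4 \<le> card (nbr V f a x \<union> nbr V f a y)"
      using richD[OF r, of x y a] xy AB \<open>x \<noteq> y\<close> True by auto
    then have "nbr V f a x \<union> nbr V f a y \<noteq> {}" by auto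
    then obtain z where z: "z \<in> nbr V f a x \<union> nbr V f a y" by blast
    then have "z \<in> A" using nb[of a x y] a True xy by auto
    then show thesis using z that[of x z] that[of y z] xy a by (auto simp: nbr_iff)
  qed (use that xy \<open>x \<noteq> y\<close> in blast)
  have u: "f {u, z} \<noteq> d" if "z \<in> A" "z \<noteq> u" for z
    using star[of u v z] uv that by (cases "z = v") auto
  have all: "f {z, w} \<noteq> d" if "z \<in> A" "w \<in> A" "z \<noteq> w" for z w
  proof -
    consider "z = u" | "w = u" | "z \<noteq> u" "w \<noteq> u" by blast
    then show ?thesis
    proof cases
      case 2
      then show ?thesis using u[of z] that by (simp add: insert_commute)
    next
      case 3
      then show ?thesis using star[OF uv(1) that(1,2)] that(3) u[of z] that(1) by simp
    qed (use u[of w] that in simp)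
  qed
  obtain a b where ab: "a \<noteq> b" "a \<noteq> d" "b \<noteq> d" "{1, 2, 3} = {a, b, d}"
    using other_colors[OF dc] .
  have "card A < 6"
  proof (rule no_mono_triangle_less_6[OF fin(2) uv(1) ab(1)])
    show "f {y, z} \<in> {a, b}" if "y \<in> A" "z \<in> A" "y \<noteq> z" for y z
      using gallai_on_color[OF g, of y z] all[OF that] that AB unfolding ab(4) by auto
    show "\<not> (f {y, z} = f {y, w} \<and> f {y, z} = f {z, w})"
      if "y \<in> A" "z \<in> A" "w \<in> A" "distinct [y, z, w]" for y z w
      using star[of y z w] all that by auto
  qed
  then have "\<not> (\<exists>z\<in>A. z \<noteq> u \<and> z \<noteq> v)" using star[of u v] uv by force
  then have "A = {u, v}" using uv by blast
  then show False
  proof -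
    obtain e where e: "e \<in> {1, 2, 3}" "e \<noteq> d" "e \<noteq> f {u, v}"
      using third_color[OF dc gallai_on_color[OF g, of u v]] uv AB by (metis UnI1)
    then have "4 \<le> card (A - {u, v})"
      using rich_card_le[OF r, of u v e "A - {u, v}"] nb[of e u v] uv AB fin by auto
    then show False using \<open>A = {u, v}\<close> by simp
  qed
qed

text \<open>At a vertex of \<open>C\<close>, the two colors other than \<open>h\<close> stay inside
  \<open>C\<close> and share at most five neighbors. For \<open>h = d\<close> they would need four
  each. Otherwise the third color \<open>e\<close> takes four, leaving at most one
  \<open>d\<close>-neighbor, so the ends of an \<open>e\<close>-edge have at most two
  \<open>d\<close>-neighbors instead of three.\<close>

lemma no_mono_cut_on_12:
  assumes fin: "finite B" and dc: "d \<in> {1, 2, 3}" and hc: "h \<in> {1, 2, 3}"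
    and deg: "\<And>y b. y \<in> B \<Longrightarrow> b \<in> {1, 2, 3} - {d} \<Longrightarrow> 4 \<le> card (nbr B f b y)"
    and edg: "\<And>x y. x \<in> B \<Longrightarrow> y \<in> B \<Longrightarrow> x \<noteq> y \<Longrightarrow> f {x, y} \<noteq> d \<Longrightarrow>
      3 \<le> card (nbr B f d x \<union> nbr B f d y)"
    and CD: "C \<union> D = B" "C \<noteq> {}" "\<forall>x\<in>C. \<forall>y\<in>D. f {x, y} = h" and C: "card C \<le> 6"
  shows False
proof -
  have finC: "finite C" using fin CD by auto
  obtain y where y: "y \<in> C" using CD by blast
  have inC: "nbr B f e y \<subseteq> C - {y}" if "e \<noteq> h" "y \<in> C" for e y
    using that CD unfolding nbr_def by blast
  have disj: "card (nbr B f e y) + card (nbr B f e' y) \<le> 5"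
    if "e \<noteq> h" "e' \<noteq> h" "e \<noteq> e'" "y \<in> C" for e e' y
  proof -
    have "card (nbr B f e y) + card (nbr B f e' y) = card (nbr B f e y \<union> nbr B f e' y)"
      using fin that by (intro card_Un_disjoint [symmetric]) (auto simp: nbr_iff)
    also have "\<dots> \<le> card (C - {y})" using inC that finC by (intro card_mono) auto
    also have "\<dots> \<le> 5" using C that by simp
    finally show ?thesis .
  qed
  show False
  proof (cases "h = d")
    case True
    obtain a b where ab: "a \<noteq> b" "a \<noteq> d" "b \<noteq> d" "{1, 2, 3} = {a, b, d}"
      using other_colors[OF dc] .
    have "4 \<le> card (nbr B f a y)" "4 \<le> card (nbr B f b y)" using deg[of y] y CD ab by auto
    then show False using disj[of a b y] ab True y by simp
  next
    case False
    obtain e where e: "e \<in> {1, 2, 3}" "e \<noteq> d" "e \<noteq> h" using third_color[OF dc hc] False by metis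
    have 4: "4 \<le> card (nbr B f e y)" if "y \<in> C" for y using deg[of y e] that CD(1) e by auto
    then have "nbr B f e y \<noteq> {}" using y by fastforce
    then obtain w where w: "w \<in> nbr B f e y" by blast
    then have wC: "w \<in> C" using inC[OF e(3) y] by blast
    have "card (nbr B f d y) \<le> 1" "card (nbr B f d w) \<le> 1"
      using disj[of e d y] disj[of e d w] 4[OF y] 4[OF wC] e y wC False by simp_all
    then have "card (nbr B f d y \<union> nbr B f d w) \<le> 2"
      using card_Un_le[of "nbr B f d y" "nbr B f d w"] by simp
    moreover have "3 \<le> card (nbr B f d y \<union> nbr B f d w)"
      using edg[of y w] w wC y CD e by (auto simp: nbr_iff)
    ultimately show False by simp
  qed
qed

text \<open>The hypotheses are what richness leaves on the twelve vertices after removing a vertex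
  joined to all of them in color \<open>d\<close>.\<close>

lemma no_coloring_of_12:
  assumes g: "gallai_on B f" and B: "card B = 12" and dc: "d \<in> {1, 2, 3}"
    and deg: "\<And>y b. y \<in> B \<Longrightarrow> b \<in> {1, 2, 3} - {d} \<Longrightarrow> 4 \<le> card (nbr B f b y)"
    and edg: "\<And>x y. x \<in> B \<Longrightarrow> y \<in> B \<Longrightarrow> x \<noteq> y \<Longrightarrow> f {x, y} \<noteq> d \<Longrightarrow>
      3 \<le> card (nbr B f d x \<union> nbr B f d y)"
  shows False
proof -
  note fin = gallai_on_finite[OF g]
  have nc: "\<not> mono_cut B f"
  proof
    assume "mono_cut B f"
    then obtain C D h where CD: "C \<union> D = B" "C \<inter> D = {}" "C \<noteq> {}" "D \<noteq> {}"
      and h: "\<forall>x\<in>C. \<forall>y\<in>D. f {x, y} = h" unfolding mono_cut_def by blast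
    have h': "\<forall>x\<in>D. \<forall>y\<in>C. f {x, y} = h" using h by (metis insert_commute)
    obtain x y where "x \<in> C" "y \<in> D" using CD by blast
    then have hc: "h \<in> {1, 2, 3}" using h gallai_on_color[OF g, of x y] CD by fastforce
    have DC: "D \<union> C = B" using CD(1) by blast
    have "card C + card D = 12"
      using card_Un_disjoint[of C D] CD fin B by (metis finite_Un)
    then have "card C \<le> 6 \<or> card D \<le> 6" by linarith
    then show False
      using no_mono_cut_on_12[OF fin dc hc deg edg CD(1,3) h] no_mono_cut_on_12[OF fin dc hc deg edg DC CD(4) h']
      by blast
  qed
  obtain c \<P> where c: "c \<in> {1, 2, 3}" and P: "mono_partition B f c \<P>"
    and two: "\<exists>P\<in>\<P>. \<exists>Q\<in>\<P>. P \<noteq> Q"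
    using gallai_mono_partition[OF g] B by auto
  note part = mono_partition_part[OF P fin]
  show False
  proof (cases "c = d")
    case False
    \<comment> \<open>Each vertex has four \<open>c\<close>-neighbors, all in its own part. Parts of
      size at least 5 exclude the small part found with \<open>k = 10\<close>.\<close>
    have five: "5 \<le> card P" if PP: "P \<in> \<P>" for P
    proof -
      obtain x where x: "x \<in> P" using part(2)[OF PP] by blast
      have "nbr B f c x \<subseteq> P - {x}"
        using mono_partition_outside[OF P PP x] unfolding nbr_def by blast
      then have "card (nbr B f c x) \<le> card P - 1"
        using card_mono[of "P - {x}"] part(3)[OF PP] x by simp
      moreover have "4 \<le> card (nbr B f c x)" using deg[of x c] x part(1)[OF PP] c False by blast
      ultimately show ?thesis by linarith
    qed
    have "10 \<le> card P + card Q" if "P \<in> \<P>" "Q \<in> \<P>" "P \<noteq> Q" for P Q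
      using five[OF that(1)] five[OF that(2)] by simp
    then obtain P where "P \<in> \<P>" "card P \<le> 3"
      using small_path_end[OF fin P c nc two, of 10] B by auto
    then show False using five[of P] by simp
  next
    case True
    \<comment> \<open>Three neighbors plus \<open>x\<close> and \<open>y\<close>; the bound 24 < 25
      is just enough to exclude five parts.\<close>
    have k: "5 \<le> card P + card Q" if PQ: "P \<in> \<P>" "Q \<in> \<P>" "P \<noteq> Q" for P Q
    proof -
      obtain x y where xy: "x \<in> P" "y \<in> Q" using part(2) PQ by blast
      note p = mono_partition_pair[OF P fin PQ xy]
      have "x \<in> B" "y \<in> B" using part(1) PQ xy by blast+
      then have "3 \<le> card (nbr B f c x \<union> nbr B f c y)" using edg[OF _ _ p(1)] p(2) True by simp
      then show ?thesis using p(3) by linarith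
    qed
    obtain P Q a where PQ: "P \<in> \<P>" "Q \<in> \<P> - {P}" and a: "a \<in> {1, 2, 3} - {c}"
      and s: "card P \<le> 3" "card Q \<le> 3"
      and o: "\<forall>x\<in>P. \<forall>z\<in>B - P. f {x, z} \<noteq> c \<and> (f {x, z} = a \<longrightarrow> z \<in> Q)"
      using small_path_end[OF fin P c nc two k] B by auto
    obtain x where x: "x \<in> P" using part(2)[OF PQ(1)] by blast
    have xB: "x \<in> B" using x part(1)[OF PQ(1)] by blast
    have "4 \<le> card (nbr B f a x)" using deg[OF xB] a True by simp
    \<comment> \<open>Four \<open>a\<close>-neighbors do not fit into \<open>Q\<close>, so one lies
      in \<open>P\<close>. This gives an edge inside \<open>P\<close> of color other than
      \<open>c\<close>, whose ends have too few \<open>c\<close>-neighbors.\<close>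
    then have "\<not> nbr B f a x \<subseteq> Q" using card_mono[of Q "nbr B f a x"] s part(3)[of Q] PQ by fastforce
    then obtain w where w: "w \<in> B" "w \<noteq> x" "f {x, w} = a" "w \<notin> Q" unfolding nbr_def by blast
    then have wP: "w \<in> P" using o x by blast
    have ca: "c \<noteq> f {x, w}" using w a by simp
    have "3 \<le> card (nbr B f c x \<union> nbr B f c w)" using edg[of x w] xB w ca True by simp
    then have "(3::nat) \<le> 1"
      using small_part_contradiction[OF part(3,1)[OF PQ(1)] s(1) x wP w(2)[symmetric], of f c 3]
        mono_partition_outside[OF P PQ(1)] ca by auto
    then show False by simp
  qed
qed

text \<open>The small side is a single vertex \<open>x\<close>. On an edge \<open>x y\<close> it
  contributes no neighbors in colors other than \<open>d\<close>, so \<open>y\<close> alone has four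
  of each. In color \<open>d\<close> it is a neighbor of everyone, so its removal lowers the bound
  from 4 to 3.\<close>

lemma no_rich_with_mono_cut:
  assumes g: "gallai_on V f" and r: "rich V f 4" and V: "card V = 13"
    and AB: "A \<union> B = V" "A \<inter> B = {}" "A \<noteq> {}" "B \<noteq> {}" and d: "\<forall>x\<in>A. \<forall>y\<in>B. f {x, y} = d"
    and A: "card A \<le> 6"
  shows False
proof -
  note fin = gallai_on_finite[OF g]
  obtain x where x: "x \<in> A" using AB by blast
  obtain y where y: "y \<in> B" using AB by blast
  have dc: "d \<in> {1, 2, 3}" using gallai_on_color[OF g, of x y] x y d AB by fastforce
  have "A = {x}" using small_side_singleton[OF g r AB(1,2) d A _ _ dc] x by blast
  then have V_eq: "V = insert x B" "x \<notin> B" using AB by auto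
  have dx: "f {x, y} = d" if "y \<in> B" for y using d x that by blast
  have gB: "gallai_on B f" using gallai_on_subset[OF g] V_eq by blast
  have nx: "nbr V f b x = {}" if "b \<noteq> d" for b using that dx V_eq by (auto simp: nbr_iff)
  have nB: "nbr V f b y = nbr B f b y" if "b \<noteq> d" "y \<in> B" for b y
  proof -
    have "f {y, x} \<noteq> b" using dx[OF that(2)] that(1) insert_commute[of x y "{}"] by simp
    then show ?thesis unfolding nbr_def V_eq(1) by auto
  qed
  have nd: "nbr V f d y \<subseteq> insert x (nbr B f d y)" for y unfolding nbr_def V_eq(1) by auto
  show False
  proof (rule no_coloring_of_12[OF gB _ dc])
    show "card B = 12" using V V_eq fin by simp
    show "4 \<le> card (nbr B f b y)" if "y \<in> B" "b \<in> {1, 2, 3} - {d}" for y b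
    proof -
      have "4 \<le> card (nbr V f b x \<union> nbr V f b y)"
        using that V_eq dx[OF that(1)] by (intro richD[OF r]) auto
      then show ?thesis using nx nB that by simp
    qed
    show "3 \<le> card (nbr B f d y \<union> nbr B f d z)"
      if h: "y \<in> B" "z \<in> B" "y \<noteq> z" "f {y, z} \<noteq> d" for y z
    proof -
      have finB: "finite (nbr B f d y \<union> nbr B f d z)" using fin V_eq by simp
      have "4 \<le> card (insert x (nbr B f d y \<union> nbr B f d z))"
        using nd h V_eq finB dc by (intro rich_card_le[OF r, of y z d]) auto
      also have "\<dots> \<le> Suc (card (nbr B f d y \<union> nbr B f d z))"
        using finB by (simp add: card_insert_if)
      finally show ?thesis by simp
    qed
  qed
qed

lemma not_rich_on_13:
  assumes g: "gallai_on V f" and V: "card V = 13"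
  shows "\<not> rich V f 4"
proof
  assume r: "rich V f 4"
  have "mono_cut V f" using no_rich_without_mono_cut[OF g r V] by blast
  then obtain A B d where AB: "A \<union> B = V" "A \<inter> B = {}" "A \<noteq> {}" "B \<noteq> {}"
    and d: "\<forall>x\<in>A. \<forall>y\<in>B. f {x, y} = d" unfolding mono_cut_def by blast
  have d': "\<forall>x\<in>B. \<forall>y\<in>A. f {x, y} = d" using d by (metis insert_commute)
  have BA: "B \<union> A = V" "B \<inter> A = {}" using AB by auto
  have "card A + card B = 13"
    using card_Un_disjoint[of A B] AB gallai_on_finite[OF g] V by (metis finite_Un)
  then have "card A \<le> 6 \<or> card B \<le> 6" by linarith
  then show False
    using no_rich_with_mono_cut[OF g r V AB d] no_rich_with_mono_cut[OF g r V BA AB(4,3) d'] by blast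
qed

section \<open>Copies of books in complete graphs\<close>

lemma doubleton_in_nsets: "{u, v} \<in> [V]\<^bsup>2\<^esup> \<longleftrightarrow> u \<in> V \<and> v \<in> V \<and> u \<noteq> v"
  by (auto simp: nsets_def card_insert_if)

lemma graph_iso_image:
  assumes "inj_on \<phi> (verts G)" "edges G \<subseteq> Pow (verts G)"
  shows "graph_iso G (\<phi> ` verts G, (`) \<phi> ` edges G)"
  unfolding graph_iso_def fst_conv snd_conv
proof (intro exI conjI ballI)
  show "bij_betw \<phi> (verts G) (\<phi> ` verts G)" using assms(1) by (simp add: bij_betw_def)
  fix u v assume uv: "u \<in> verts G" "v \<in> verts G"
  have "\<phi> ` {u, v} \<in> (`) \<phi> ` edges G \<longleftrightarrow> {u, v} \<in> edges G"
  proof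
    assume "\<phi> ` {u, v} \<in> (`) \<phi> ` edges G"
    then obtain e where e: "e \<in> edges G" "\<phi> ` {u, v} = \<phi> ` e" by blast
    then have "{u, v} = e"
      using inj_on_image_eq_iff[OF assms(1), of "{u, v}" e] assms(2) uv by auto
    then show "{u, v} \<in> edges G" using e by simp
  qed blast
  then show "{u, v} \<in> edges G \<longleftrightarrow> {\<phi> u, \<phi> v} \<in> (`) \<phi> ` edges G" by simp
qed

lemma verts_book: "verts (book n) = {Inl 0, Inl 1} \<union> Inr ` {..<n}"
  by (auto simp: book_def graph_join_def complete_graph_def empty_graph_def)

lemma edges_book:
  "edges (book n) = insert {Inl 0, Inl 1} ((\<lambda>v. {Inl 0, Inr v}) ` {..<n} \<union> (\<lambda>v. {Inl 1, Inr v}) ` {..<n})"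
proof -
  have "[{..<2::nat}]\<^bsup>2\<^esup> = {{0, 1}}"
  proof -
    have "{..<2::nat} = {0, 1}" by auto
    then show ?thesis by (auto simp: nsets_def card_2_iff doubleton_eq_iff)
  qed
  then show ?thesis
    by (auto simp: book_def graph_join_def complete_graph_def empty_graph_def less_2_cases_iff)
qed

text \<open>The copy is the image of the book under a map taking the spine to \<open>x y\<close> and
  the pages onto \<open>Z\<close>. Its edge set is given explicitly because the colors on it have to
  be counted.\<close>

lemma book_subgraph:
  assumes xy: "x \<in> V" "y \<in> V" "x \<noteq> y" and Z: "Z \<subseteq> V - {x, y}" "card Z = n" "finite Z" and V: "V = {..<p}"
  shows "\<exists>H. subgraph H (complete_graph p) \<and> graph_iso (book n) H \<and>
    edges H = insert {x, y} ((\<lambda>z. {x, z}) ` Z \<union> (\<lambda>z. {y, z}) ` Z)"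
proof -
  obtain h where h: "bij_betw h {..<n} Z"
    using ex_bij_betw_nat_finite[OF Z(3)] Z(2) by (auto simp: atLeast0LessThan)
  define \<phi> :: "nat + nat \<Rightarrow> nat" where "\<phi> = case_sum (\<lambda>i. if i = 0 then x else y) h"
  have \<phi>: "\<phi> (Inl 0) = x" "\<phi> (Inl 1) = y" "\<And>i. \<phi> (Inr i) = h i" by (simp_all add: \<phi>_def)
  then have \<phi>1: "\<phi> (Inl (Suc 0)) = y" by simp
  have hZ: "h ` {..<n} = Z" and hinj: "inj_on h {..<n}" using h by (simp_all add: bij_betw_def)
  define H where "H = (\<phi> ` verts (book n), (`) \<phi> ` edges (book n))"
  have vH: "verts H = {x, y} \<union> Z"
    unfolding H_def verts_book fst_conv image_Un image_insert image_image \<phi> hZ by simp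
  have eH: "edges H = insert {x, y} ((\<lambda>z. {x, z}) ` Z \<union> (\<lambda>z. {y, z}) ` Z)"
    unfolding H_def edges_book snd_conv image_Un image_insert image_image \<phi> image_empty
      hZ[symmetric] by simp
  have hne: "h i \<noteq> x \<and> h i \<noteq> y \<and> x \<noteq> h i \<and> y \<noteq> h i" if "i < n" for i
    using that Z(1) hZ by blast
  have "inj_on \<phi> (verts (book n))"
    unfolding verts_book using hinj hne xy(3) by (auto simp: inj_on_def \<phi> \<phi>1)
  moreover have "edges (book n) \<subseteq> Pow (verts (book n))"
    unfolding verts_book edges_book by auto
  ultimately have "graph_iso (book n) H" unfolding H_def by (rule graph_iso_image)
  moreover have "subgraph H (complete_graph p)"
    unfolding subgraph_def simple_graph_def vH eH complete_graph_def fst_conv snd_conv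
    using xy Z V by (auto simp: doubleton_in_nsets)
  ultimately show ?thesis using eH by blast
qed

lemma graph_iso_bookD:
  assumes "graph_iso (book n) H"
  obtains x y Z where "x \<noteq> y" "x \<notin> Z" "y \<notin> Z" "card Z = n" "finite Z" "verts H = {x, y} \<union> Z"
    "{x, y} \<in> edges H" "\<forall>z\<in>Z. {x, z} \<in> edges H \<and> {y, z} \<in> edges H"
proof -
  obtain \<phi> where b: "bij_betw \<phi> (verts (book n)) (verts H)"
    and e: "\<And>u v. u \<in> verts (book n) \<Longrightarrow> v \<in> verts (book n) \<Longrightarrow>
      {u, v} \<in> edges (book n) \<longleftrightarrow> {\<phi> u, \<phi> v} \<in> edges H"
    using assms unfolding graph_iso_def by blast
  have inj: "inj_on \<phi> ({Inl 0, Inl 1} \<union> Inr ` {..<n})" and im: "verts H = \<phi> ` ({Inl 0, Inl 1} \<union> Inr ` {..<n})"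
    using b by (simp_all add: bij_betw_def verts_book)
  show thesis
  proof (rule that[of "\<phi> (Inl 0)" "\<phi> (Inl 1)" "\<phi> ` Inr ` {..<n}"])
    show "\<phi> (Inl 0) \<noteq> \<phi> (Inl 1)" using inj_onD[OF inj, of "Inl 0" "Inl 1"] by auto
    show "\<phi> (Inl 0) \<notin> \<phi> ` Inr ` {..<n}" "\<phi> (Inl 1) \<notin> \<phi> ` Inr ` {..<n}"
      using inj_onD[OF inj] by blast+
    have "inj_on \<phi> (Inr ` {..<n})" using inj by (rule inj_on_subset) auto
    then show "card (\<phi> ` Inr ` {..<n}) = n" by (simp add: card_image)
    show "finite (\<phi> ` Inr ` {..<n})" by simp
    show "verts H = {\<phi> (Inl 0), \<phi> (Inl 1)} \<union> \<phi> ` Inr ` {..<n}" using im by auto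
    show "{\<phi> (Inl 0), \<phi> (Inl 1)} \<in> edges H"
      using e[of "Inl 0" "Inl 1"] by (simp add: verts_book edges_book)
    show "\<forall>z\<in>\<phi> ` Inr ` {..<n}. {\<phi> (Inl 0), z} \<in> edges H \<and> {\<phi> (Inl 1), z} \<in> edges H"
    proof
      fix z assume "z \<in> \<phi> ` Inr ` {..<n}"
      then obtain i where i: "i < n" "z = \<phi> (Inr i)" by blast
      have "{Inl 0, Inr i} \<in> edges (book n)" "{Inl 1, Inr i} \<in> edges (book n)"
        using i(1) unfolding edges_book by blast+
      then show "{\<phi> (Inl 0), z} \<in> edges H \<and> {\<phi> (Inl 1), z} \<in> edges H"
        using e[of "Inl 0" "Inr i"] e[of "Inl 1" "Inr i"] i by (simp add: verts_book)
    qed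
  qed
qed

lemma gallai_coloring_gallai_on:
  "gallai_coloring 3 p f \<longleftrightarrow> gallai_on {..<p} f"
proof -
  have "{1..3::nat} = {1, 2, 3}" by auto
  moreover have "(\<forall>S\<in>[{..<p}]\<^bsup>2\<^esup>. f S \<in> {1, 2, 3}) \<longleftrightarrow>
      (\<forall>x\<in>{..<p}. \<forall>y\<in>{..<p}. x \<noteq> y \<longrightarrow> f {x, y} \<in> {1, 2, 3})" (is "?L \<longleftrightarrow> ?R")
  proof
    show ?R if ?L
    proof (intro ballI impI)
      fix x y assume "x \<in> {..<p}" "y \<in> {..<p}" "x \<noteq> y"
      then have "{x, y} \<in> [{..<p}]\<^bsup>2\<^esup>" unfolding doubleton_in_nsets by blast
      then show "f {x, y} \<in> {1, 2, 3}" by (rule bspec[OF that])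
    qed
    show ?L if ?R
    proof
      fix S assume "S \<in> [{..<p}]\<^bsup>2\<^esup>"
      then obtain x y where "S = {x, y}" "x \<noteq> y" "x \<in> {..<p}" "y \<in> {..<p}"
        by (auto simp: nsets_def card_2_iff)
      then show "f S \<in> {1, 2, 3}" using that by blast
    qed
  qed
  ultimately show ?thesis
    by (simp only: gallai_coloring_def coloring_def rainbow_triangle_def gallai_on_def
        complete_graph_def fst_conv snd_conv Pi_iff finite_lessThan) blast
qed

section \<open>The book in K_13 and the block coloring of K_12\<close>

lemma few_color_book_in_13:
  assumes "gallai_coloring 3 13 f"
  shows "\<exists>H. subgraph H (complete_graph 13) \<and> graph_iso (book 8) H \<and> card (f ` edges H) \<le> 2"
proof -
  define V where "V = {..<13::nat}"
  have V: "card V = 13" "finite V" by (simp_all add: V_def)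
  have g: "gallai_on V f" using assms by (simp add: gallai_coloring_gallai_on V_def)
  obtain x y b where xy: "x \<in> V" "y \<in> V" "x \<noteq> y" and b: "b \<in> {1, 2, 3}" "b \<noteq> f {x, y}"
    and c: "card (nbr V f b x \<union> nbr V f b y) < 4"
    using not_rich_on_13[OF g V(1)] unfolding rich_def by (meson linorder_not_le)
  \<comment> \<open>Besides \<open>x\<close>, \<open>y\<close> and at most three vertices joined to
    them in color \<open>b\<close>, at least 13 - 2 - 3 = 8 vertices remain as pages, and the
    resulting book avoids \<open>b\<close>.\<close>
  let ?N = "nbr V f b x \<union> nbr V f b y"
  have "card (V - ({x, y} \<union> ?N)) = card V - card ({x, y} \<union> ?N)"
    using xy V by (intro card_Diff_subset) (auto simp: nbr_iff)
  moreover have "card ({x, y} \<union> ?N) \<le> card {x, y} + card ?N" by (rule card_Un_le)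
  ultimately have "8 \<le> card (V - ({x, y} \<union> ?N))" using c V xy by simp
  then obtain Z where Z: "Z \<subseteq> V - ({x, y} \<union> ?N)" "card Z = 8" "finite Z"
    by (meson obtain_subset_with_card_n)
  then have "Z \<subseteq> V - {x, y}" by blast
  from book_subgraph[OF xy this Z(2,3) V_def] obtain H where
    H: "subgraph H (complete_graph 13)" "graph_iso (book 8) H"
    and e: "edges H = insert {x, y} ((\<lambda>z. {x, z}) ` Z \<union> (\<lambda>z. {y, z}) ` Z)" by blast
  have "f {x, z} \<in> {1, 2, 3} - {b}" "f {y, z} \<in> {1, 2, 3} - {b}" if "z \<in> Z" for z
    using that Z(1) gallai_on_color[OF g, of x z] gallai_on_color[OF g, of y z] xy
    unfolding nbr_def by blast+
  moreover have "f {x, y} \<in> {1, 2, 3} - {b}" using gallai_on_color[OF g xy] b by simp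
  ultimately have "f ` edges H \<subseteq> {1, 2, 3} - {b}" unfolding e by blast
  then have "card (f ` edges H) \<le> card ({1, 2, 3} - {b})" by (intro card_mono) auto
  also have "\<dots> = 2" using b(1) by auto
  finally show ?thesis using H by blast
qed

text \<open>Four blocks of three vertices; the colors 1 and 2 between the blocks form two
  complementary paths on four vertices.\<close>

definition block_coloring :: "nat set \<Rightarrow> nat" where
  "block_coloring S =
     (let i = Min S div 3; j = Max S div 3 in if i = j then 3 else if j = Suc i then 1 else 2)"

lemma block_coloring_doubleton:
  "block_coloring {x, y} = (if x div 3 = y div 3 then 3
     else if x div 3 = Suc (y div 3) \<or> y div 3 = Suc (x div 3) then 1 else 2)"
proof (cases "x \<le> y")
  case True
  then have "x div 3 \<le> y div 3" by (rule div_le_mono)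
  then show ?thesis using True by (auto simp: block_coloring_def Let_def)
next
  case False
  then have "y div 3 \<le> x div 3" by (intro div_le_mono) simp
  then show ?thesis using False by (auto simp: block_coloring_def Let_def min_def max_def)
qed

text \<open>A triangle meeting at most two blocks has two edges of equal color, and one meeting
  three blocks uses only colors 1 and 2.\<close>

lemma gallai_block_coloring: "gallai_on {..<p} block_coloring"
  unfolding gallai_on_def
proof (intro conjI ballI impI)
  show "block_coloring {x, y} \<in> {1, 2, 3}" for x y by (simp add: block_coloring_doubleton)
  show "\<not> distinct [block_coloring {x, y}, block_coloring {x, z}, block_coloring {y, z}]" for x y z
    unfolding block_coloring_doubleton by (auto split: if_splits)
qed simp

text \<open>A book with at most two colors misses some color \<open>b\<close>. If
  \<open>b = 3\<close>, the spine meets two blocks, which together contain no page, and 6 + 8 > 12.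
  Otherwise some block is joined to \<open>x\<close> entirely in color \<open>b\<close> and misses
  the whole book, and 3 + 10 > 12.\<close>

lemma no_few_color_book_below_13:
  assumes p: "p < 13" and H: "subgraph H (complete_graph p)" and iso: "graph_iso (book 8) H"
  shows "\<not> card (block_coloring ` edges H) \<le> 2"
proof
  let ?f = block_coloring
  assume c: "card (?f ` edges H) \<le> 2"
  obtain x y Z where xy: "x \<noteq> y" "x \<notin> Z" "y \<notin> Z" and Z: "card Z = 8" "finite Z"
    and vH: "verts H = {x, y} \<union> Z" and eH: "{x, y} \<in> edges H" "\<forall>z\<in>Z. {x, z} \<in> edges H \<and> {y, z} \<in> edges H"
    using graph_iso_bookD[OF iso] by metis
  have "verts H \<subseteq> {..<p}" "finite (edges H)"
    using H finite_subset[of "edges H" "[{..<p}]\<^bsup>2\<^esup>"]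
    by (simp_all add: subgraph_def complete_graph_def finite_imp_finite_nsets)
  then have sub: "{x, y} \<union> Z \<subseteq> {..<12}" using vH p by auto
  have "\<not> {1, 2, 3} \<subseteq> ?f ` edges H"
    using card_mono[of "?f ` edges H" "{1, 2, 3}"] \<open>finite (edges H)\<close> c by auto
  then obtain b where b: "b \<in> {1, 2, 3}" "b \<notin> ?f ` edges H" by blast
  have nb: "?f {x, y} \<noteq> b" "\<And>z. z \<in> Z \<Longrightarrow> ?f {x, z} \<noteq> b" "\<And>z. z \<in> Z \<Longrightarrow> ?f {y, z} \<noteq> b"
    using b(2) eH by blast+
  have block: "{3 * j..<3 * j + 3} \<subseteq> {..<12::nat}" if "j < 4" for j using that by auto
  have div_block: "z div 3 = j" if "z \<in> {3 * j..<3 * j + 3}" for z j :: nat using that by auto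
  have lt: "x div 3 < 4" "y div 3 < 4" using sub by auto
  have card_xyZ: "card ({x, y} \<union> Z) = 10"
    using card_Un_disjoint[of "{x, y}" Z] xy Z by simp
  show False
  proof (cases "b = 3")
    case True
    let ?U = "{3 * (x div 3)..<3 * (x div 3) + 3} \<union> {3 * (y div 3)..<3 * (y div 3) + 3}"
    have ne: "x div 3 \<noteq> y div 3" using nb(1) True by (auto simp: block_coloring_doubleton)
    then have "card ?U = 6" using div_block by (subst card_Un_disjoint) fastforce+
    moreover have "?U \<inter> Z = {}"
      using nb(2,3) True div_block by (fastforce simp: block_coloring_doubleton)
    then have "card (?U \<union> Z) = card ?U + card Z" using Z by (intro card_Un_disjoint) auto
    moreover have "card (?U \<union> Z) \<le> card {..<12::nat}"
      using block[OF lt(1)] block[OF lt(2)] sub by (intro card_mono) auto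
    ultimately show False using Z by simp
  next
    case False
    have b': "b \<in> {1, 2}" using b False by auto
    \<comment> \<open>The witnesses are neighbors of \<open>i\<close> on the path 0-1-2-3 for color
      1 and on its complement 2-0-3-1 for color 2.\<close>
    have path: "\<exists>j<4. i \<noteq> j \<and> (b = 1 \<longleftrightarrow> i = Suc j \<or> j = Suc i)" if "i < 4" for i
      using that b'
      by (intro exI[of _ "if b = 1 then (if i = 0 then 1 else i - 1)
          else (if i = 0 then 2 else if i = 1 then 3 else 0)"]) auto
    obtain i where i: "x div 3 = i" by blast
    obtain j where j: "j < 4" "i \<noteq> j" "b = 1 \<longleftrightarrow> i = Suc j \<or> j = Suc i"
      using path[of i] lt(1) i by blast
    let ?U = "{3 * j..<3 * j + 3}"
    have fU: "?f {x, z} = b" if "z \<in> ?U" for z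
      using j b' unfolding block_coloring_doubleton i div_block[OF that] by auto
    have "x \<notin> ?U" using div_block[of x j] j(2) unfolding i by blast
    then have "?U \<inter> ({x, y} \<union> Z) = {}" using fU nb by blast
    then have "card (?U \<union> ({x, y} \<union> Z)) = card ?U + card ({x, y} \<union> Z)"
      using Z by (intro card_Un_disjoint) auto
    moreover have "card (?U \<union> ({x, y} \<union> Z)) \<le> card {..<12::nat}"
      using block[OF j(1)] sub by (intro card_mono) auto
    ultimately show False using card_xyZ by simp
  qed
qed

theorem theorem4p4:
  shows "weakened_gallai_ramsey 3 2 (book 8) = 13"
  unfolding weakened_gallai_ramsey_def
proof (rule cInf_eq_minimum)
  show "13 \<in> {p. \<forall>f. gallai_coloring 3 p f \<longrightarrow>
      (\<exists>H. subgraph H (complete_graph p) \<and> graph_iso (book 8) H \<and> card (f ` edges H) \<le> 2)}"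
    using few_color_book_in_13 by blast
next
  fix p
  assume "p \<in> {p. \<forall>f. gallai_coloring 3 p f \<longrightarrow>
      (\<exists>H. subgraph H (complete_graph p) \<and> graph_iso (book 8) H \<and> card (f ` edges H) \<le> 2)}"
  then obtain H where "subgraph H (complete_graph p)" "graph_iso (book 8) H"
    "card (block_coloring ` edges H) \<le> 2"
    using gallai_block_coloring[of p] unfolding gallai_coloring_gallai_on mem_Collect_eq by blast
  then show "13 \<le> p" using no_few_color_book_below_13[of p H] by linarith
qed

end
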